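(* Let $n$ range over the even positive integers, and consider a uniformly random binary functional graph of size $n$. As $n\to\infty$, the expected values of the following parameters have the following asymptotic forms, each up to an additive error $o(1)$: (i) number of components: $\dfrac{\ln(2n)+\gamma}{2}$; (ii) number of cyclic nodes: $\sqrt{\pi n/2}-1$; (iii) number of tail nodes: $n-\sqrt{\pi n/2}+1$; (iv) number of terminal nodes: $n/2$; (v) number of image nodes: $n/2$.
   Context: A functional graph of size $n$ is the directed graph on the labeled vertex set $\{1,\dots,n\}$ associated with a map $f:\{1,\dots,n\}\to\{1,\dots,n\}$, having an edge $\langle a,b\rangle$ if and only if $f(a)=b$. It is a binary functional graph if each node has in-degree exactly $0$ or $2$ (such graphs exist only for even $n$). A random binary functional graph of size $n$ is chosen uniformly from all binary functional graphs on $\{1,\dots,n\}$. A component is a connected component of the graph with edge directions ignored (a cycle together with the trees grafted onto its nodes). A cyclic node is a node lying on a directed cycle (fixed points are cycles of length $1$); a tail node is a node that is not cyclic. A node $x$ is terminal if $f^{-1}(x)=\emptyset$, and is an image node otherwise. $\gamma\approx 0.57721566$ is the Euler constant. *)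

theory Defs
  imports
    "HOL-Probability.Probability"
    "HOL-Library.Landau_Symbols"
    "Graph_Theory.Graph_Theory"
begin

definition functional_graph :: "nat \<Rightarrow> (nat \<Rightarrow> nat) \<Rightarrow> nat pair_pre_digraph" where
  "functional_graph n f =
     \<lparr> pverts = {1..n}, parcs = {(a, b). a \<in> {1..n} \<and> b \<in> {1..n} \<and> f a = b} \<rparr>"

definition functional_graphs :: "nat \<Rightarrow> nat pair_pre_digraph set" where
  "functional_graphs n = functional_graph n ` ({1..n} \<rightarrow> {1..n})"

definition binary_functional_graphs :: "nat \<Rightarrow> nat pair_pre_digraph set" where
  "binary_functional_graphs n =
     {G \<in> functional_graphs n. \<forall>v \<in> pverts G. in_degree (with_proj G) v \<in> {0, 2}}"

definition random_bfg :: "nat \<Rightarrow> nat pair_pre_digraph pmf" where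
  "random_bfg n = pmf_of_set (binary_functional_graphs n)"

text \<open>
  Forgetting the directions of the edges is \<^const>\<open>mk_symmetric\<close>; strongly connected
  components of the resulting symmetric digraph are the connected components of the
  underlying undirected graph.
\<close>

definition graph_components :: "'a pair_pre_digraph \<Rightarrow> ('a, 'a \<times> 'a) pre_digraph set" where
  "graph_components G = pre_digraph.sccs (with_proj (mk_symmetric (with_proj G)))"

text \<open>
  The cycles of \<^const>\<open>pre_digraph.cycle\<close> are nonempty lists of arcs and include loops, so
  fixed points are cyclic.
\<close>

definition cyclic_nodes :: "'a pair_pre_digraph \<Rightarrow> 'a set" where
  "cyclic_nodes G =
     {v \<in> pverts G. \<exists>p. pre_digraph.cycle (with_proj G) p \<and> v \<in> fst ` set p}"

definition tail_nodes :: "'a pair_pre_digraph \<Rightarrow> 'a set" where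
  "tail_nodes G = pverts G - cyclic_nodes G"

text \<open>
  For the graph of a map \<open>f\<close>, the set of all \<open>y\<close> with an edge from \<open>y\<close> to \<open>x\<close> is the preimage
  of \<open>x\<close> under \<open>f\<close>.
\<close>

definition terminal_nodes :: "'a pair_pre_digraph \<Rightarrow> 'a set" where
  "terminal_nodes G = {x \<in> pverts G. {y. (y, x) \<in> parcs G} = {}}"

definition image_nodes :: "'a pair_pre_digraph \<Rightarrow> 'a set" where
  "image_nodes G = pverts G - terminal_nodes G"

definition expected_card :: "nat \<Rightarrow> (nat pair_pre_digraph \<Rightarrow> 'b set) \<Rightarrow> real" where
  "expected_card n X = measure_pmf.expectation (random_bfg n) (\<lambda>G. real (card (X G)))"

definition even_at_top :: "nat filter" where
  "even_at_top = inf at_top (principal {n. even n})"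

text \<open>
  \<^const>\<open>pmf_of_set\<close> is the uniform distribution only on finite nonempty sets; the next two
  facts show that this is the case for every even size.
\<close>

lemma finite_binary_functional_graphs: "finite (binary_functional_graphs n)"
proof -
  have "functional_graphs n \<subseteq> (\<lambda>A. \<lparr> pverts = {1..n}, parcs = A \<rparr>) ` Pow ({1..n} \<times> {1..n})"
    unfolding functional_graphs_def functional_graph_def
    by (intro image_subsetI imageI PowI subsetI) auto
  then have "finite (functional_graphs n)"
    by (rule finite_subset) simp
  then show ?thesis
    by (simp add: binary_functional_graphs_def)
qed

lemma binary_functional_graphs_nonempty:
  assumes "even n"
  shows "binary_functional_graphs n \<noteq> {}"
proof -
  obtain m where n: "n = 2 * m" using assms by blast
  let ?f = "\<lambda>x::nat. (x + 1) div 2"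
  let ?G = "functional_graph n ?f"
  have f: "?f \<in> {1..n} \<rightarrow> {1..n}" by auto
  have "in_degree (with_proj ?G) v \<in> {0, 2}" if "v \<in> {1..n}" for v
  proof (cases "v \<le> m")
    case True
    have "in_arcs (with_proj ?G) v = {(2 * v - 1, v), (2 * v, v)}"
      using that True n by (auto simp: in_arcs_def functional_graph_def)
    moreover have "2 * v - 1 \<noteq> 2 * v" using that by auto
    ultimately show ?thesis by (simp add: in_degree_def)
  next
    case False
    have "in_arcs (with_proj ?G) v = {}"
      using that False n by (auto simp: in_arcs_def functional_graph_def)
    then show ?thesis by (simp add: in_degree_def)
  qed
  then have "?G \<in> binary_functional_graphs n"
    using f by (auto simp: binary_functional_graphs_def functional_graphs_def functional_graph_def)
  then show ?thesis by blast
qed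

end

theory Submission
  imports Defs "HOL-Combinatorics.Orbits" "HOL-Real_Asymp.Real_Asymp"
begin

text \<open>
  Let \<open>n = 2 m\<close>. A binary map amounts to a choice of its \<open>m\<close> image points and a distribution of the
  \<open>n\<close> points into fibres of size 2. If \<open>k\<close> given points are required to form a cycle, they are image
  points with one preimage left to choose each, so the same count applies to the remaining \<open>n - k\<close>
  points. Hence the expected number of points on cycles of length \<open>k\<close> is
  \<open>2 ^ k * ((2 * m - k) choose m) / ((2 * m) choose m)\<close>. Summing over \<open>k\<close> gives the exact expected
  number \<open>4 ^ m / ((2 * m) choose m) - 1\<close> of cyclic nodes. Components correspond to cycles, that is
  to cyclic points weighted by \<open>1 / k\<close>; the weighted sum increases by \<open>1 / (2 * m + 1)\<close> from \<open>m\<close> to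
  \<open>m + 1\<close>, so it equals \<open>1 + 1 / 3 + \<dots> + 1 / (2 * m - 1)\<close>. The asymptotics follow
  from Wallis' product and from the definition of the Euler constant.
\<close>

section \<open>Counting maps with prescribed fibres\<close>

text \<open>The extensional function space gives each map on \<open>A\<close> exactly one
  representative, so that cardinalities count maps.\<close>

definition maps_with_fibres :: "'a set \<Rightarrow> 'b set \<Rightarrow> ('b \<Rightarrow> nat) \<Rightarrow> ('a \<Rightarrow> 'b) set" where
  "maps_with_fibres A V d = {f \<in> A \<rightarrow>\<^sub>E V. \<forall>v\<in>V. card {a\<in>A. f a = v} = d v}"

lemma finite_maps_with_fibres: "finite A \<Longrightarrow> finite V \<Longrightarrow> finite (maps_with_fibres A V d)"
  by (rule finite_subset[of _ "A \<rightarrow>\<^sub>E V"]) (auto simp: maps_with_fibres_def intro: finite_PiE)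

text \<open>Case split on the value \<open>v\<close> of the new point: removing \<open>a\<close>
  lowers the required fibre size at \<open>v\<close> by one. The guard \<open>d v > 0\<close> keeps
  the truncated subtraction honest.\<close>

lemma maps_with_fibres_insert:
  assumes "finite A" "a \<notin> A"
  shows "maps_with_fibres (insert a A) V d =
    (\<Union>v\<in>{v\<in>V. d v > 0}. (\<lambda>g. g(a := v)) ` maps_with_fibres A V (d(v := d v - 1)))"
proof (intro equalityI subsetI)
  fix f assume f: "f \<in> maps_with_fibres (insert a A) V d"
  define g where "g = f(a := undefined)"
  have fa: "f a \<in> V" using f by (auto simp: maps_with_fibres_def)
  have fib: "card {b\<in>insert a A. f b = v} = d v" if "v \<in> V" for v
    using f that by (auto simp: maps_with_fibres_def)
  have split: "{b\<in>insert a A. f b = v} =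
      (if v = f a then insert a {b\<in>A. g b = v} else {b\<in>A. g b = v})" for v
    using assms by (auto simp: g_def)
  have fib': "d v = card {b\<in>A. g b = v} + (if v = f a then 1 else 0)" if "v \<in> V" for v
  proof -
    have "d v = card (if v = f a then insert a {b\<in>A. g b = v} else {b\<in>A. g b = v})"
      using fib[OF that] split[of v] by simp
    then show ?thesis using assms by (cases "v = f a") auto
  qed
  have "g \<in> maps_with_fibres A V (d(f a := d (f a) - 1))"
    unfolding maps_with_fibres_def
  proof (intro CollectI conjI ballI)
    show "g \<in> A \<rightarrow>\<^sub>E V"
      using f assms by (auto simp: g_def maps_with_fibres_def PiE_def Pi_def extensional_def)
  next
    fix v assume "v \<in> V"
    then show "card {b\<in>A. g b = v} = (d(f a := d (f a) - 1)) v"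
      using fib'[of v] by (cases "v = f a") simp_all
  qed
  moreover have "f = g(a := f a)" by (simp add: g_def)
  moreover have "d (f a) > 0" using fib'[OF fa] by simp
  ultimately show "f \<in> (\<Union>v\<in>{v\<in>V. d v > 0}. (\<lambda>g. g(a := v)) ` maps_with_fibres A V (d(v := d v - 1)))"
    using fa by blast
next
  fix f assume "f \<in> (\<Union>v\<in>{v\<in>V. d v > 0}. (\<lambda>g. g(a := v)) ` maps_with_fibres A V (d(v := d v - 1)))"
  then obtain v g where v: "v \<in> V" "d v > 0" and f: "f = g(a := v)"
    and g: "g \<in> maps_with_fibres A V (d(v := d v - 1))" by blast
  show "f \<in> maps_with_fibres (insert a A) V d"
    unfolding maps_with_fibres_def
  proof (intro CollectI conjI ballI)
    show "f \<in> insert a A \<rightarrow>\<^sub>E V"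
      using g v unfolding f by (auto simp: maps_with_fibres_def PiE_def Pi_def extensional_def)
  next
    fix w assume w: "w \<in> V"
    have "card {b\<in>A. g b = w} = (d(v := d v - 1)) w"
      using g w by (simp add: maps_with_fibres_def)
    moreover have "{b\<in>insert a A. f b = w} =
        (if w = v then insert a {b\<in>A. g b = w} else {b\<in>A. g b = w})"
      using assms unfolding f by auto
    ultimately show "card {b\<in>insert a A. f b = w} = d w"
      using v assms by auto
  qed
qed

text \<open>The multinomial coefficient, multiplied out to stay within the naturals. Sending the new
  point to \<open>v\<close> contributes \<open>d v * fact (card A)\<close>, and the
  \<open>d v\<close> add up to \<open>card A + 1\<close>.\<close>

lemma card_maps_with_fibres:
  fixes A :: "'a set"
  assumes "finite A" "finite V" "sum d V = card A"
  shows "card (maps_with_fibres A V d) * (\<Prod>v\<in>V. fact (d v)) = fact (card A)"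
  using assms(1,3)
proof (induction A arbitrary: d rule: finite_induct)
  case empty
  then have d: "d v = 0" if "v \<in> V" for v using that assms(2) by simp
  then have "maps_with_fibres ({} :: 'a set) V d = {\<lambda>_. undefined}"
    by (auto simp: maps_with_fibres_def)
  then show ?case using d by simp
next
  case (insert a A)
  let ?M = "\<lambda>v. maps_with_fibres A V (d(v := d v - 1))"
  let ?V = "{v\<in>V. d v > 0}"
  have inj: "inj_on (\<lambda>g. g(a := v)) (?M v)" for v
  proof (rule inj_onI)
    fix g h assume "g \<in> ?M v" "h \<in> ?M v" and eq: "g(a := v) = h(a := v)"
    then have "g a = h a" using insert.hyps
      by (auto simp: maps_with_fibres_def PiE_def extensional_def)
    then show "g = h" using eq by (metis fun_upd_triv fun_upd_upd)
  qed
  \<comment> \<open>The images for different \<open>v\<close> are disjoint because the value at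
    \<open>a\<close> reveals \<open>v\<close>.\<close>
  have "card (maps_with_fibres (insert a A) V d) = (\<Sum>v\<in>?V. card (?M v))"
    unfolding maps_with_fibres_insert[OF insert.hyps]
    using inj insert.hyps assms(2)
    by (subst card_UN_disjoint)
      (auto simp: finite_maps_with_fibres card_image fun_upd_def dest: fun_cong[of _ _ a])
  also have "\<dots> * (\<Prod>v\<in>V. fact (d v)) = (\<Sum>v\<in>?V. d v * fact (card A))"
    unfolding sum_distrib_right
  proof (intro sum.cong refl)
    fix v assume v: "v \<in> ?V"
    have "(\<Prod>w\<in>V. fact (d w)) = fact (d v) * (\<Prod>w\<in>V - {v}. fact (d w) :: nat)"
      using v assms(2) by (simp add: prod.remove[of V v])
    moreover have "fact (d v) = d v * (fact (d v - 1) :: nat)"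
      using v by (simp add: fact_reduce)
    moreover have "(\<Prod>w\<in>V. fact ((d(v := d v - 1)) w)) = fact (d v - 1) * (\<Prod>w\<in>V - {v}. fact (d w) :: nat)"
      using v assms(2) by (simp add: prod.remove[of V v])
    ultimately have prod: "(\<Prod>w\<in>V. fact (d w)) = d v * (\<Prod>w\<in>V. fact ((d(v := d v - 1)) w))"
      by (simp only: mult.assoc)
    have "sum d V = d v + sum d (V - {v})"
      using v assms(2) by (simp add: sum.remove)
    moreover have "sum (d(v := d v - 1)) V = d v - 1 + sum d (V - {v})"
      using v assms(2) by (simp add: sum.remove[of V v])
    ultimately have "sum (d(v := d v - 1)) V = card A"
      using insert.prems insert.hyps v by simp
    from insert.IH[OF this] show "card (?M v) * (\<Prod>w\<in>V. fact (d w)) = d v * fact (card A)"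
      unfolding prod by (metis mult.left_commute)
  qed
  also have "\<dots> = (\<Sum>v\<in>?V. d v) * fact (card A)"
    by (simp add: sum_distrib_right)
  also have "(\<Sum>v\<in>?V. d v) = sum d V"
    using assms(2) by (intro sum.mono_neutral_left) auto
  finally show ?case using insert.prems insert.hyps by (simp add: mult.commute)
qed

lemma sum_card_fibres:
  assumes "finite A" "finite V" "f \<in> A \<rightarrow> V"
  shows "(\<Sum>v\<in>V. card {a\<in>A. f a = v}) = card A"
  using sum.group[of A V f "\<lambda>_. 1::nat"] assms by auto

section \<open>Binary maps that permute a given set in a prescribed way\<close>

definition binary_maps :: "'a set \<Rightarrow> ('a \<Rightarrow> 'a) set" where
  "binary_maps V = {f \<in> V \<rightarrow>\<^sub>E V. \<forall>v\<in>V. card {a\<in>V. f a = v} \<in> {0, 2}}"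

lemma finite_binary_maps: "finite V \<Longrightarrow> finite (binary_maps V)"
  by (rule finite_subset[of _ "V \<rightarrow>\<^sub>E V"]) (auto simp: binary_maps_def intro: finite_PiE)

text \<open>Let \<open>k = card X\<close> and let \<open>S\<close> be the set of points outside
  \<open>X\<close> that are hit twice. Adding up fibre sizes gives
  \<open>k + 2 * card S = 2 * m - k\<close>, hence \<open>card S = m - k\<close>. Each
  \<open>S\<close> admits \<open>(2 * m - k)! / 2 ^ (m - k)\<close> maps, and choosing
  \<open>m - k\<close> of \<open>2 * m - k\<close> points is the same as leaving out
  \<open>m\<close>. For \<open>k > m\<close> both sides are 0, so the truncated exponent does no
  harm.\<close>

lemma card_maps_off_cycle:
  assumes "finite V" "X \<subseteq> V" and V: "card V = 2 * m"
  shows "card {g \<in> (V - X) \<rightarrow>\<^sub>E V. (\<forall>v\<in>X. card {a\<in>V-X. g a = v} = 1) \<and>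
                    (\<forall>v\<in>V-X. card {a\<in>V-X. g a = v} \<in> {0, 2})} * 2 ^ (m - card X)
      = ((2 * m - card X) choose m) * fact (2 * m - card X)"
    (is "card ?G * _ = _")
proof -
  have fin: "finite X" "finite (V - X)" using assms finite_subset by auto
  have cX: "card X \<le> 2 * m" using assms by (metis card_mono)
  have cVX: "card (V - X) = 2 * m - card X" using assms fin by (simp add: card_Diff_subset)
  \<comment> \<open>Stating the size condition without subtraction makes this family empty when
    \<open>card X > m\<close>.\<close>
  define \<S> where "\<S> = {S. S \<subseteq> V - X \<and> card X + 2 * card S = card (V - X)}"
  define d where "d S v = (if v \<in> X then 1 else if v \<in> S then 2 else 0 :: nat)" for S v
  have fin\<S>: "finite \<S>" using fin by (auto simp: \<S>_def intro: finite_subset[of _ "Pow (V - X)"])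
  have sumd: "sum (d S) V = card X + 2 * card S" if "S \<subseteq> V - X" for S
  proof -
    have "sum (d S) V = sum (d S) X + sum (d S) (V - X)"
      using assms by (metis add.commute sum.subset_diff)
    also have "sum (d S) X = card X" by (simp add: d_def)
    also have "sum (d S) (V - X) = (\<Sum>v\<in>V-X. if v \<in> S then 2 else 0)"
      by (intro sum.cong) (auto simp: d_def)
    also have "\<dots> = 2 * card S"
      using fin that by (simp add: sum.If_cases Int_absorb1)
    finally show ?thesis .
  qed
  have G: "?G = (\<Union>S\<in>\<S>. maps_with_fibres (V - X) V (d S))"
  proof (intro equalityI subsetI)
    fix g assume g: "g \<in> ?G"
    define S where "S = {v\<in>V-X. card {a\<in>V-X. g a = v} = 2}"
    have S: "S \<subseteq> V - X" by (auto simp: S_def)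
    have gm: "g \<in> maps_with_fibres (V - X) V (d S)"
      using g by (auto simp: maps_with_fibres_def d_def S_def)
    have "card (V - X) = (\<Sum>v\<in>V. card {a\<in>V-X. g a = v})"
      using g assms fin by (intro sum_card_fibres[symmetric]) auto
    also have "\<dots> = sum (d S) V"
      using gm by (auto simp: maps_with_fibres_def)
    finally have "S \<in> \<S>" using sumd[OF S] S by (simp add: \<S>_def)
    then show "g \<in> (\<Union>S\<in>\<S>. maps_with_fibres (V - X) V (d S))" using gm by blast
  next
    fix g assume "g \<in> (\<Union>S\<in>\<S>. maps_with_fibres (V - X) V (d S))"
    then show "g \<in> ?G" using assms by (auto simp: maps_with_fibres_def d_def split: if_splits)
  qed
  have "card ?G = (\<Sum>S\<in>\<S>. card (maps_with_fibres (V - X) V (d S)))"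
    unfolding G
  proof (rule card_UN_disjoint[OF fin\<S>])
    show "\<forall>S\<in>\<S>. finite (maps_with_fibres (V - X) V (d S))"
      using fin assms by (simp add: finite_maps_with_fibres)
    show "\<forall>S\<in>\<S>. \<forall>T\<in>\<S>. S \<noteq> T \<longrightarrow>
        maps_with_fibres (V - X) V (d S) \<inter> maps_with_fibres (V - X) V (d T) = {}"
    proof (intro ballI impI)
      fix S T assume ST: "S \<in> \<S>" "T \<in> \<S>" "S \<noteq> T"
      show "maps_with_fibres (V - X) V (d S) \<inter> maps_with_fibres (V - X) V (d T) = {}"
      proof (rule ccontr)
        assume "\<not> ?thesis"
        then obtain g where "g \<in> maps_with_fibres (V - X) V (d S)" "g \<in> maps_with_fibres (V - X) V (d T)"
          by blast
        then have "d S v = d T v" if "v \<in> V" for v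
          using that by (simp add: maps_with_fibres_def)
        then have "v \<in> S \<longleftrightarrow> v \<in> T" if "v \<in> V - X" for v
          using that \<open>\<And>v. v \<in> V \<Longrightarrow> d S v = d T v\<close>[of v] by (simp add: d_def split: if_splits)
        then show False using ST by (auto simp: \<S>_def)
      qed
    qed
  qed
  also have "\<dots> * 2 ^ (m - card X) = (\<Sum>S\<in>\<S>. fact (2 * m - card X))"
    unfolding sum_distrib_right
  proof (intro sum.cong refl)
    fix S assume S: "S \<in> \<S>"
    then have SV: "S \<subseteq> V - X" and cS: "card S = m - card X"
      using cVX cX by (auto simp: \<S>_def)
    have "(\<Prod>v\<in>V. fact (d S v)) = (\<Prod>v\<in>V. if v \<in> S then 2 else 1 :: nat)"
      using SV by (intro prod.cong) (auto simp: d_def)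
    also have "\<dots> = 2 ^ card S"
      using assms(1) SV by (simp add: prod.If_cases Int_absorb1 subset_iff)
    finally have "(\<Prod>v\<in>V. fact (d S v)) = (2 ^ (m - card X) :: nat)" by (simp add: cS)
    then show "card (maps_with_fibres (V - X) V (d S)) * 2 ^ (m - card X) = fact (2 * m - card X)"
      using card_maps_with_fibres[of "V - X" V "d S"] sumd[OF SV] S fin assms(1) cVX
      by (simp add: \<S>_def)
  qed
  also have "\<dots> = card \<S> * fact (2 * m - card X)" by simp
  also have "card \<S> = (2 * m - card X) choose m"
  proof (cases "card X \<le> m")
    case True
    then have "\<S> = {S. S \<subseteq> V - X \<and> card S = m - card X}"
      using cVX by (auto simp: \<S>_def)
    then have "card \<S> = (2 * m - card X) choose (m - card X)"
      using n_subsets[OF fin(2)] cVX by simp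
    also have "\<dots> = (2 * m - card X) choose m"
      using binomial_symmetric[of m "2 * m - card X"] True by simp
    finally show ?thesis .
  next
    case False
    then have "\<S> = {}" using cVX cX by (auto simp: \<S>_def)
    then show ?thesis using False cX by (simp add: binomial_eq_0)
  qed
  finally show ?thesis .
qed

text \<open>Since \<open>h\<close> permutes \<open>X\<close>, every point of \<open>X\<close> gets
  exactly one preimage from inside \<open>X\<close> and every other point gets none. Restricting to
  \<open>V - X\<close> therefore leaves the situation of \<open>card_maps_off_cycle\<close>.\<close>

lemma card_binary_maps_extending:
  assumes "finite V" "X \<subseteq> V" and V: "card V = 2 * m" and h: "bij_betw h X X"
  shows "card {f \<in> binary_maps V. \<forall>x\<in>X. f x = h x} * 2 ^ (m - card X)
      = ((2 * m - card X) choose m) * fact (2 * m - card X)"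
proof -
  let ?F = "{f \<in> binary_maps V. \<forall>x\<in>X. f x = h x}"
  let ?G = "{g \<in> (V - X) \<rightarrow>\<^sub>E V. (\<forall>v\<in>X. card {a\<in>V-X. g a = v} = 1) \<and>
                    (\<forall>v\<in>V-X. card {a\<in>V-X. g a = v} \<in> {0, 2})}"
  have fin: "finite X" "finite (V - X)" using assms finite_subset by auto
  have hX: "h x \<in> X" if "x \<in> X" for x using h that by (auto simp: bij_betw_def)
  have fib: "card {a\<in>V. f a = v} = card {a\<in>V-X. f a = v} + (if v \<in> X then 1 else 0)"
    if f: "\<forall>x\<in>X. f x = h x" for f v
  proof -
    have "{a\<in>V. f a = v} = {a\<in>V-X. f a = v} \<union> {a\<in>X. h a = v}" using f assms by auto
    moreover have "{a\<in>V-X. f a = v} \<inter> {a\<in>X. h a = v} = {}" by auto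
    ultimately have "card {a\<in>V. f a = v} = card {a\<in>V-X. f a = v} + card {a\<in>X. h a = v}"
      using fin by (simp add: card_Un_disjoint)
    moreover have "card {a\<in>X. h a = v} = (if v \<in> X then 1 else 0)"
    proof (cases "v \<in> X")
      case True
      then have "v \<in> h ` X" using h by (simp add: bij_betw_def)
      then obtain x where "x \<in> X" "h x = v" by blast
      then have "{a\<in>X. h a = v} = {x}" using h by (auto simp: bij_betw_def inj_on_def)
      then show ?thesis using True by simp
    next
      case False
      then have empty: "{a\<in>X. h a = v} = {}" using hX by auto
      show ?thesis unfolding empty using False by simp
    qed
    ultimately show ?thesis by simp
  qed
  have "bij_betw (\<lambda>f. restrict f (V - X)) ?F ?G"
  proof (rule bij_betw_byWitness[where f' = "\<lambda>g x. if x \<in> X then h x else g x"])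
    show "\<forall>f\<in>?F. (\<lambda>x. if x \<in> X then h x else restrict f (V - X) x) = f"
      by (auto simp: binary_maps_def fun_eq_iff PiE_def extensional_def)
    show "\<forall>g\<in>?G. restrict (\<lambda>x. if x \<in> X then h x else g x) (V - X) = g"
      by (auto simp: fun_eq_iff PiE_def extensional_def)
    show "(\<lambda>f. restrict f (V - X)) ` ?F \<subseteq> ?G"
    proof (intro image_subsetI)
      fix f assume f: "f \<in> ?F"
      have eq: "{a\<in>V-X. restrict f (V - X) a = v} = {a\<in>V-X. f a = v}" for v by auto
      have fX: "\<forall>x\<in>X. f x = h x" using f by simp
      have "card {a\<in>V. f a = v} \<in> {0, 2}" if "v \<in> V" for v
        using f that by (auto simp: binary_maps_def)
      \<comment> \<open>For \<open>v\<close> in \<open>X\<close> the total is at least 1, so it must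
        be 2, which leaves exactly one preimage outside \<open>X\<close>.\<close>
      then have fibV: "card {a\<in>V-X. f a = v} + (if v \<in> X then 1 else 0) \<in> {0, 2}" if "v \<in> V" for v
        using that unfolding fib[OF fX] by blast
      have "card {a\<in>V-X. f a = v} = 1" if "v \<in> X" for v
        using fibV[of v] that assms(2) by auto
      moreover have "card {a\<in>V-X. f a = v} \<in> {0, 2}" if "v \<in> V - X" for v
        using fibV[of v] that by simp
      moreover have "restrict f (V - X) \<in> (V - X) \<rightarrow>\<^sub>E V"
        using f by (auto simp: binary_maps_def)
      ultimately show "restrict f (V - X) \<in> ?G" unfolding mem_Collect_eq eq by blast
    qed
    show "(\<lambda>g x. if x \<in> X then h x else g x) ` ?G \<subseteq> ?F"
    proof (intro image_subsetI)
      fix g assume g: "g \<in> ?G"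
      let ?f = "\<lambda>x. if x \<in> X then h x else g x"
      have eq: "{a\<in>V-X. ?f a = v} = {a\<in>V-X. g a = v}" for v by auto
      have "card {a\<in>V. ?f a = v} = card {a\<in>V-X. g a = v} + (if v \<in> X then 1 else 0)" for v
        using fib[of ?f v] unfolding eq by simp
      then have "\<forall>v\<in>V. card {a\<in>V. ?f a = v} \<in> {0, 2}"
        using g by auto
      moreover have "?f \<in> V \<rightarrow>\<^sub>E V"
        using g hX assms(2) by (auto simp: PiE_def Pi_def extensional_def)
      ultimately show "?f \<in> ?F" by (simp add: binary_maps_def)
    qed
  qed
  then have "card ?F = card ?G" by (rule bij_betw_same_card)
  then show ?thesis using card_maps_off_cycle[OF assms(1,2) V] by simp
qed

text \<open>The equation \<open>map f xs = rotate1 xs\<close> says that \<open>f\<close> sends each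
  entry to the next one and the last to the first, which prescribes \<open>f\<close> on
  \<open>set xs\<close> as a permutation. The empty list is allowed and later yields the total
  number of binary maps.\<close>

lemma card_binary_maps_along_cycle:
  assumes "finite V" and V: "card V = 2 * m" and xs: "distinct xs" "set xs \<subseteq> V"
  shows "card {f \<in> binary_maps V. map f xs = rotate1 xs} * 2 ^ (m - length xs)
      = ((2 * m - length xs) choose m) * fact (2 * m - length xs)"
proof -
  define h where "h x = the (map_of (zip xs (rotate1 xs)) x)" for x
  have h: "map h xs = rotate1 xs"
    using xs(1) by (intro nth_equalityI) (auto simp: h_def map_of_zip_nth)
  have "h ` set xs = set xs" using arg_cong[OF h, of set] by simp
  then have "bij_betw h (set xs) (set xs)"
    by (simp add: bij_betw_def eq_card_imp_inj_on)
  moreover have "{f \<in> binary_maps V. map f xs = rotate1 xs} = {f \<in> binary_maps V. \<forall>x\<in>set xs. f x = h x}"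
    unfolding h[symmetric] by (simp add: map_eq_conv)
  ultimately show ?thesis
    using card_binary_maps_extending[OF assms(1) xs(2) V] distinct_card[OF xs(1)] by simp
qed

section \<open>Points on cycles\<close>

text \<open>\<open>orbit f x\<close> consists of the iterates with positive exponent, so membership
  of \<open>x\<close> expresses a genuine return to \<open>x\<close>; fixed points are
  included.\<close>

definition cyclic_points :: "('a \<Rightarrow> 'a) \<Rightarrow> 'a set \<Rightarrow> 'a set" where
  "cyclic_points f V = {x\<in>V. x \<in> orbit f x}"

lemma card_orbit_self:
  assumes "x \<in> orbit f x"
  shows "card (orbit f x) = funpow_dist1 f x x"
  using orbit_conv_funpow_dist1[OF assms] inj_on_funpow_dist1[OF assms]
  by (metis card_atLeastLessThan card_image diff_zero)

text \<open>A point on a cycle of length \<open>k\<close> corresponds to the list of that cycle read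
  off from the point onwards; \<open>hd\<close> recovers the point. This turns counting cyclic
  points into counting lists.\<close>

lemma bij_betw_cyclic_points:
  assumes f: "f \<in> V \<rightarrow> V" and k: "k > 0"
  shows "bij_betw (\<lambda>x. map (\<lambda>i. (f ^^ i) x) [0..<k])
    {x \<in> cyclic_points f V. card (orbit f x) = k}
    {xs \<in> {xs. length xs = k \<and> distinct xs \<and> set xs \<subseteq> V}. map f xs = rotate1 xs}"
proof (rule bij_betw_byWitness[where f' = hd])
  have fV: "(f ^^ i) x \<in> V" if "x \<in> V" for x i
    using that f by (induction i) auto
  show "\<forall>x\<in>{x \<in> cyclic_points f V. card (orbit f x) = k}. hd (map (\<lambda>i. (f ^^ i) x) [0..<k]) = x"
    using k by (simp add: hd_map)
  \<comment> \<open>A list that \<open>f\<close> rotates is determined by its head.\<close>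
  have nth: "xs ! i = (f ^^ i) (hd xs)"
    if "map f xs = rotate1 xs" "length xs = k" "i < k" for xs i
    using that(3)
  proof (induction i)
    case 0
    then show ?case using that by (cases xs) auto
  next
    case (Suc i)
    have "f (xs ! i) = rotate1 xs ! i" using that Suc by (metis Suc_lessD nth_map)
    also have "\<dots> = xs ! Suc i" using that Suc by (simp add: nth_rotate1)
    finally show ?case using Suc by simp
  qed
  show "\<forall>xs\<in>{xs \<in> {xs. length xs = k \<and> distinct xs \<and> set xs \<subseteq> V}. map f xs = rotate1 xs}.
      map (\<lambda>i. (f ^^ i) (hd xs)) [0..<k] = xs"
    using nth by (auto intro!: nth_equalityI)
  show "(\<lambda>x. map (\<lambda>i. (f ^^ i) x) [0..<k]) ` {x \<in> cyclic_points f V. card (orbit f x) = k}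
    \<subseteq> {xs \<in> {xs. length xs = k \<and> distinct xs \<and> set xs \<subseteq> V}. map f xs = rotate1 xs}"
  proof (intro image_subsetI)
    fix x assume "x \<in> {x \<in> cyclic_points f V. card (orbit f x) = k}"
    then have x: "x \<in> V" "x \<in> orbit f x" and k': "k = funpow_dist1 f x x"
      using card_orbit_self[of x f] by (auto simp: cyclic_points_def)
    let ?xs = "map (\<lambda>i. (f ^^ i) x) [0..<k]"
    have "distinct ?xs" using inj_on_funpow_dist1[OF x(2)] unfolding k' distinct_map by (simp del: upt_Suc)
    moreover have "map f ?xs = rotate1 ?xs"
    proof (rule nth_equalityI)
      fix i assume "i < length (map f ?xs)"
      then have i: "i < k" by simp
      show "map f ?xs ! i = rotate1 ?xs ! i"
      proof (cases "Suc i < k")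
        case True
        then show ?thesis using i by (simp add: nth_rotate1)
      next
        case False
        \<comment> \<open>The last entry wraps around: \<open>k\<close> is the first return time of
          \<open>x\<close>.\<close>
        then have "Suc i = k" using i by simp
        then have "(f ^^ Suc i) x = x" using funpow_dist1_prop[OF x(2)] k' by metis
        then have "f ((f ^^ i) x) = x" by (simp only: funpow.simps comp_apply)
        then show ?thesis using i k \<open>Suc i = k\<close> by (simp add: nth_rotate1 del: upt_Suc)
      qed
    qed simp
    ultimately show "?xs \<in> {xs \<in> {xs. length xs = k \<and> distinct xs \<and> set xs \<subseteq> V}. map f xs = rotate1 xs}"
      using fV x by auto
  qed
  show "hd ` {xs \<in> {xs. length xs = k \<and> distinct xs \<and> set xs \<subseteq> V}. map f xs = rotate1 xs}
    \<subseteq> {x \<in> cyclic_points f V. card (orbit f x) = k}"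
  proof (intro image_subsetI)
    fix xs assume "xs \<in> {xs \<in> {xs. length xs = k \<and> distinct xs \<and> set xs \<subseteq> V}. map f xs = rotate1 xs}"
    then have xs: "length xs = k" "distinct xs" "set xs \<subseteq> V" "map f xs = rotate1 xs" by auto
    let ?x = "hd xs"
    have "xs \<noteq> []" using xs k by auto
    then have x: "?x \<in> V" using xs by auto
    have "f (xs ! (k - 1)) = rotate1 xs ! (k - 1)" using xs k by (metis diff_less nth_map zero_less_one)
    also have "\<dots> = ?x" using xs k by (simp add: nth_rotate1 hd_conv_nth \<open>xs \<noteq> []\<close>)
    finally have "f ((f ^^ (k - 1)) ?x) = ?x" using nth[OF xs(4,1)] k by simp
    then have per: "(f ^^ k) ?x = ?x" using k by (metis Suc_diff_1 comp_apply funpow.simps(2))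
    then have "?x \<in> orbit f ?x" using k unfolding orbit_altdef by force
    moreover have "orbit f ?x = set xs"
      unfolding orbit_altdef_bounded[OF per k] using nth[OF xs(4,1)] xs(1)
      by (auto simp: set_conv_nth) metis+
    ultimately show "?x \<in> {x \<in> cyclic_points f V. card (orbit f x) = k}"
      using x distinct_card[OF xs(2)] xs(1) by (simp add: cyclic_points_def)
  qed
qed

text \<open>For \<open>0 < k\<close> and \<open>k \<le> 2 * m\<close> this is the mean number of
  points on cycles of length \<open>k\<close>. At \<open>k = 0\<close> the formula has value 1,
  which starts the recurrence and completes the binomial sum.\<close>

definition cycle_weight :: "nat \<Rightarrow> nat \<Rightarrow> real" where
  "cycle_weight m k = 2 ^ k * real ((2 * m - k) choose m) / real ((2 * m) choose m)"

text \<open>Double counting of pairs of a map and a list that it rotates. All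
  \<open>(2 * m)! / (2 * m - k)!\<close> lists of \<open>k\<close> distinct points are rotated by
  the same number of maps.\<close>

lemma sum_card_cyclic_points_of_length:
  assumes "finite V" and V: "card V = 2 * m" and k: "k > 0" "k \<le> 2 * m"
  shows "(\<Sum>f\<in>binary_maps V. real (card {x \<in> cyclic_points f V. card (orbit f x) = k}))
     = cycle_weight m k * real (card (binary_maps V))"
proof -
  let ?L = "{xs. length xs = k \<and> distinct xs \<and> set xs \<subseteq> V}"
  \<comment> \<open>\<open>?c j\<close> counts the maps that follow a given cycle of length
    \<open>j\<close>, and \<open>?c 0\<close> counts all binary maps.\<close>
  let ?c = "\<lambda>j. ((2 * m - j) choose m) * fact (2 * m - j) / 2 ^ (m - j) :: real"
  have finL: "finite ?L"
    by (rule finite_subset[OF _ finite_lists_length_eq[OF assms(1), of k]]) auto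
  have count: "real (card {f \<in> binary_maps V. map f xs = rotate1 xs}) = ?c (length xs)"
    if "distinct xs" "set xs \<subseteq> V" for xs
    using arg_cong[OF card_binary_maps_along_cycle[OF assms(1) V that], of real]
    by (simp add: field_simps)
  have B: "real (card (binary_maps V)) = ?c 0" using count[of "[]"] by simp
  have "(\<Sum>f\<in>binary_maps V. card {x \<in> cyclic_points f V. card (orbit f x) = k})
      = (\<Sum>f\<in>binary_maps V. card {xs\<in>?L. map f xs = rotate1 xs})"
    using k by (intro sum.cong bij_betw_same_card[OF bij_betw_cyclic_points]) (auto simp: binary_maps_def)
  also have "\<dots> = (\<Sum>xs\<in>?L. card {f \<in> binary_maps V. map f xs = rotate1 xs})"
    unfolding card_eq_sum by (rule sum.swap_restrict[OF finite_binary_maps[OF assms(1)] finL])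
  finally have "(\<Sum>f\<in>binary_maps V. real (card {x \<in> cyclic_points f V. card (orbit f x) = k}))
     = (\<Sum>xs\<in>?L. real (card {f \<in> binary_maps V. map f xs = rotate1 xs}))"
    unfolding of_nat_sum[symmetric] by (rule arg_cong)
  also have "\<dots> = real (card ?L) * ?c k"
    using count by simp
  also have "real (card ?L) = fact (2 * m) / fact (2 * m - k)"
  proof -
    have "card ?L = \<Prod>{2 * m - k + 1..2 * m}"
      using card_lists_distinct_length_eq[OF assms(1), of k] k V by simp
    then have "card ?L = fact (2 * m) div fact (2 * m - k)"
      using fact_div_fact[of "2 * m - k" "2 * m"] by simp
    then have "card ?L * fact (2 * m - k) = fact (2 * m)"
      by (simp only: dvd_div_mult_self[OF fact_dvd[OF diff_le_self]])
    from arg_cong[OF this, of real] show ?thesis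
      by (simp only: of_nat_mult of_nat_fact) (simp add: eq_divide_eq)
  qed
  also have "fact (2 * m) / fact (2 * m - k) * ?c k = cycle_weight m k * ?c 0"
  proof (cases "k \<le> m")
    case True
    then have "(2::real) ^ m = 2 ^ k * 2 ^ (m - k)" by (simp flip: power_add)
    then show ?thesis by (simp add: cycle_weight_def field_simps)
  next
    case False
    then show ?thesis using k by (simp add: cycle_weight_def binomial_eq_0)
  qed
  finally show ?thesis using B by simp
qed

lemma orbit_cyclic_point:
  assumes "finite V" "f \<in> V \<rightarrow> V" "x \<in> cyclic_points f V"
  shows "orbit f x \<subseteq> V" "card (orbit f x) \<in> {1..card V}"
proof -
  show sub: "orbit f x \<subseteq> V"
  proof
    fix y assume "y \<in> orbit f x"
    then show "y \<in> V" using assms by induction (auto simp: cyclic_points_def)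
  qed
  have "x \<in> orbit f x" using assms by (simp add: cyclic_points_def)
  then show "card (orbit f x) \<in> {1..card V}"
    using sub assms(1) card_mono[OF assms(1) sub] finite_subset[OF sub]
    by (auto simp: Suc_le_eq card_gt_0_iff)
qed

lemma sum_over_cyclic_points:
  fixes w :: "nat \<Rightarrow> real"
  assumes "finite V" "f \<in> V \<rightarrow> V"
  shows "(\<Sum>x\<in>cyclic_points f V. w (card (orbit f x))) =
    (\<Sum>k=1..card V. w k * card {x \<in> cyclic_points f V. card (orbit f x) = k})"
proof -
  have "(\<Sum>x\<in>cyclic_points f V. w (card (orbit f x))) =
     (\<Sum>k=1..card V. \<Sum>x\<in>{x \<in> cyclic_points f V. card (orbit f x) = k}. w (card (orbit f x)))"
    using orbit_cyclic_point(2)[OF assms] assms(1)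
    by (intro sum.group[symmetric]) (auto simp: cyclic_points_def)
  then show ?thesis by (simp add: mult.commute)
qed

text \<open>A cycle with \<open>c\<close> points is counted \<open>c\<close> times with weight
  \<open>1 / c\<close>, since all its points have the cycle itself as orbit.\<close>

lemma card_cycles:
  assumes "finite V"  "f \<in> V \<rightarrow> V"
  shows "real (card (orbit f ` cyclic_points f V)) = (\<Sum>x\<in>cyclic_points f V. 1 / card (orbit f x))"
proof -
  have fin: "finite (cyclic_points f V)" using assms by (simp add: cyclic_points_def)
  have "(\<Sum>x\<in>cyclic_points f V. 1 / card (orbit f x)) =
    (\<Sum>C\<in>orbit f ` cyclic_points f V. \<Sum>x\<in>{x\<in>cyclic_points f V. orbit f x = C}. 1 / real (card (orbit f x)))"
    using fin by (intro sum.group[symmetric]) auto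
  also have "\<dots> = (\<Sum>C\<in>orbit f ` cyclic_points f V. 1)"
  proof (intro sum.cong refl)
    fix C assume "C \<in> orbit f ` cyclic_points f V"
    then obtain y where y: "y \<in> cyclic_points f V" "C = orbit f y" by auto
    then have yC: "y \<in> C" by (simp add: cyclic_points_def)
    then have cyc: "cyclic_on f C" using y(2) by (rule cyclic_on_singleI)
    have "C \<subseteq> V" using orbit_cyclic_point(1)[OF assms y(1)] y(2) by simp
    then have "{x\<in>cyclic_points f V. orbit f x = C} = C"
      using orbit_cyclic_eq3[OF cyc] by (auto simp: cyclic_points_def)
    moreover have "card C > 0" using orbit_cyclic_point(2)[OF assms y(1)] y by simp
    moreover have "(\<Sum>x\<in>{x\<in>cyclic_points f V. orbit f x = C}. 1 / real (card (orbit f x))) =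
      (\<Sum>x\<in>{x\<in>cyclic_points f V. orbit f x = C}. 1 / real (card C))"
      by (intro sum.cong) auto
    ultimately show "(\<Sum>x\<in>{x\<in>cyclic_points f V. orbit f x = C}. 1 / real (card (orbit f x))) = 1"
      by simp
  qed
  finally show ?thesis by simp
qed

text \<open>The weight \<open>w = 1\<close> will give the cyclic nodes, and
  \<open>w k = 1 / k\<close> the cycles and thereby the components.\<close>

lemma sum_binary_maps_cyclic_points:
  fixes w :: "nat \<Rightarrow> real"
  assumes "finite V" and V: "card V = 2 * m"
  shows "(\<Sum>f\<in>binary_maps V. \<Sum>x\<in>cyclic_points f V. w (card (orbit f x))) =
    (\<Sum>k=1..2*m. w k * cycle_weight m k) * card (binary_maps V)"
proof -
  have "(\<Sum>f\<in>binary_maps V. \<Sum>x\<in>cyclic_points f V. w (card (orbit f x))) =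
    (\<Sum>f\<in>binary_maps V. \<Sum>k=1..2*m. w k * card {x \<in> cyclic_points f V. card (orbit f x) = k})"
    using sum_over_cyclic_points[OF assms(1), of _ w] V
    by (intro sum.cong) (auto simp: binary_maps_def)
  also have "\<dots> = (\<Sum>k=1..2*m. w k * (\<Sum>f\<in>binary_maps V. real (card {x \<in> cyclic_points f V. card (orbit f x) = k})))"
    by (subst sum.swap) (simp add: sum_distrib_left)
  also have "\<dots> = (\<Sum>k=1..2*m. w k * (cycle_weight m k * card (binary_maps V)))"
    using sum_card_cyclic_points_of_length[OF assms] by (intro sum.cong) auto
  finally show ?thesis by (simp add: sum_distrib_right mult.assoc)
qed

text \<open>The fibres partition \<open>V\<close> and the nonempty ones have two elements, so
  exactly half of the points are hit.\<close>

lemma card_unhit_binary_map: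
  assumes "finite V" and f: "f \<in> binary_maps V"
  shows "2 * card {v\<in>V. {a\<in>V. f a = v} = {}} = card V"
proof -
  define T where "T = {v\<in>V. {a\<in>V. f a = v} = {}}"
  have T: "T \<subseteq> V" by (auto simp: T_def)
  have "card V = (\<Sum>v\<in>V. card {a\<in>V. f a = v})"
    using f by (intro sum_card_fibres[symmetric] assms(1)) (auto simp: binary_maps_def)
  also have "\<dots> = (\<Sum>v\<in>V - T. 2)"
  proof (intro sum.mono_neutral_cong_right ballI)
    fix v assume v: "v \<in> V - T"
    then have "card {a\<in>V. f a = v} \<in> {0, 2}" using f by (auto simp: binary_maps_def)
    moreover have "finite {a\<in>V. f a = v}" using assms by simp
    ultimately show "card {a\<in>V. f a = v} = 2" using v by (auto simp: T_def)
  qed (use assms(1) in \<open>auto simp: T_def\<close>)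
  also have "\<dots> = 2 * (card V - card T)"
    using assms(1) T by (simp add: card_Diff_subset finite_subset)
  finally show ?thesis using card_mono[OF assms(1) T] unfolding T_def[symmetric] by simp
qed

section \<open>Summation and asymptotics\<close>

lemma cycle_weight_eq_0: "m < k \<Longrightarrow> k \<le> 2 * m \<Longrightarrow> cycle_weight m k = 0"
  by (simp add: cycle_weight_def)

text \<open>With \<open>k = m - j\<close> the sum from \<open>k = 0\<close> becomes a multiple of
  the sum of \<open>((m + j) choose j) / 2 ^ j\<close> over \<open>j \<le> m\<close>, which is
  \<open>2 ^ m\<close>. The term at \<open>k = 0\<close> accounts for the final
  \<open>- 1\<close>.\<close>

lemma sum_cycle_weight:
  "(\<Sum>k=1..2*m. cycle_weight m k) = 4 ^ m / real ((2 * m) choose m) - 1"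
proof -
  have "(\<Sum>k=0..m. cycle_weight m k) = (\<Sum>j=0..m. cycle_weight m (m - j))"
    by (rule sum.atLeastAtMost_rev[of "cycle_weight m" 0 m, simplified])
  also have "\<dots> = (\<Sum>j\<le>m. 2 ^ m * ((of_nat (m + j) gchoose j) / 2 ^ j) / real ((2 * m) choose m))"
  proof (intro sum.cong)
    fix j assume "j \<in> {..m}"
    then have j: "j \<le> m" by simp
    have "(2::real) ^ m = 2 ^ (m - j) * 2 ^ j" using j by (simp flip: power_add)
    moreover have "2 * m - (m - j) = m + j" using j by simp
    moreover have "(m + j) choose m = (m + j) choose j"
      using binomial_symmetric[of m "m + j"] by simp
    ultimately show "cycle_weight m (m - j) = 2 ^ m * ((of_nat (m + j) gchoose j) / 2 ^ j) / real ((2 * m) choose m)"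
      by (simp add: cycle_weight_def binomial_gbinomial)
  qed auto
  also have "\<dots> = 2 ^ m * (\<Sum>j\<le>m. (of_nat (m + j) gchoose j) / 2 ^ j) / real ((2 * m) choose m)"
    by (simp add: sum_distrib_left sum_divide_distrib)
  also have "\<dots> = 2 ^ m * 2 ^ m / real ((2 * m) choose m)"
    using gbinomial_sum_nat_pow2[of m, where ?'a = real] by simp
  also have "\<dots> = 4 ^ m / real ((2 * m) choose m)" by (simp flip: power_mult_distrib)
  finally have "(\<Sum>k=0..m. cycle_weight m k) = 4 ^ m / real ((2 * m) choose m)" .
  moreover have "(\<Sum>k=0..m. cycle_weight m k) = (\<Sum>k=0..2*m. cycle_weight m k)"
    by (intro sum.mono_neutral_left) (auto simp: cycle_weight_eq_0)
  moreover have "(\<Sum>k=0..2*m. cycle_weight m k) = cycle_weight m 0 + (\<Sum>k=1..2*m. cycle_weight m k)"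
    by (subst sum.atLeast_Suc_atMost) auto
  moreover have "cycle_weight m 0 = 1" by (simp add: cycle_weight_def)
  ultimately show ?thesis by simp
qed

section \<open>The weighted sum for components, by telescoping\<close>

text \<open>The ratio of consecutive terms follows from absorption for
  \<open>(2 * m - k) choose m\<close>. The form without division remains valid for
  \<open>k \<ge> m\<close>, where both sides vanish.\<close>

lemma cycle_weight_step:
  assumes "k < 2 * m"
  shows "cycle_weight m (Suc k) * (2 * real m - real k) = cycle_weight m k * (2 * real m - 2 * real k)"
proof -
  obtain j where j: "2 * m - k = Suc j" using assms by (metis Suc_diff_Suc)
  have "(Suc j - m) * (Suc j choose m) = Suc j * (j choose m)" if "m \<le> Suc j"
    using that by (metis binomial_absorb_comp diff_Suc_1)
  then have "(real (Suc j) - real m) * real (Suc j choose m) = real (Suc j) * real (j choose m)"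
    by (cases "m \<le> Suc j") (auto simp: binomial_eq_0 simp flip: of_nat_mult of_nat_diff of_nat_Suc)
  moreover have "2 * m - Suc k = j" using j by simp
  moreover have "real (Suc j) = 2 * real m - real k" using j assms by linarith
  ultimately have "(real m - real k) * real (Suc j choose m) = (2 * real m - real k) * real (j choose m)"
    by (simp only:) (simp add: algebra_simps)
  then show ?thesis using j \<open>2 * m - Suc k = j\<close>
    by (simp add: cycle_weight_def divide_simps) (simp add: algebra_simps)
qed

text \<open>The companion ratio in the other argument. With \<open>k = m - j\<close> all binomials
  become quotients of factorials. Both ratios together reduce the telescoping identity to one
  between rational functions.\<close>

lemma cycle_weight_Suc_left:
  assumes "k \<le> m"
  shows "cycle_weight (Suc m) k * (2 * (real m + 1 - real k) * (2 * real m + 1))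
    = cycle_weight m k * ((2 * real m + 2 - real k) * (2 * real m + 1 - real k))"
proof -
  define j where "j = m - k"
  have m: "real m = real j + real k" using assms by (simp add: j_def)
  have cb: "real ((m + i) choose m) = fact (m + i) / (fact m * fact i)" for m i
    by (simp add: binomial_fact)
  have e: "2 * Suc m - k = Suc m + Suc j" "2 * m - k = m + j" "2 * Suc m = Suc m + Suc m" "2 * m = m + m"
    using assms by (auto simp: j_def)
  have f: "fact (Suc m + Suc j) = (real m + real j + 2) * (real m + real j + 1) * fact (m + j)"
    "fact (Suc m + Suc m) = (real m + real m + 2) * (real m + real m + 1) * fact (m + m)"
    "fact (Suc m) = (real m + 1) * fact m" "fact (Suc j) = (real j + 1) * fact j"
    by (simp_all add: algebra_simps)
  have nz: "real m + real j + 2 \<noteq> 0"  "real m + real j + 1 \<noteq> 0" "real m + real m + 2 \<noteq> 0"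
    "real m + real m + 1 \<noteq> 0" "real m + 1 \<noteq> 0" "real j + 1 \<noteq> 0" by linarith+
  have lhs: "cycle_weight (Suc m) k = 2 ^ k * ((real m + real j + 2) * (real m + real j + 1) * fact (m + j)
      / ((real m + 1) * fact m * ((real j + 1) * fact j))) /
      ((real m + real m + 2) * (real m + real m + 1) * fact (m + m) / ((real m + 1) * fact m * ((real m + 1) * fact m)))"
    using e(1,3) cb[of "Suc m" "Suc j"] cb[of "Suc m" "Suc m"] unfolding cycle_weight_def f by (simp only:)
  have rhs: "cycle_weight m k = 2 ^ k * (fact (m + j) / (fact m * fact j)) / (fact (m + m) / (fact m * fact m))"
    using e(2,4) cb[of m j] cb[of m m] unfolding cycle_weight_def by (simp only:)
  have p: "2 * (real m + 1 - real k) * (2 * real m + 1) = 2 * (real j + 1) * (real m + real m + 1)"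
    "(2 * real m + 2 - real k) * (2 * real m + 1 - real k) = (real m + real j + 2) * (real m + real j + 1)"
    using m by (simp_all add: algebra_simps)
  show ?thesis unfolding lhs rhs p using nz by (simp add: divide_simps) algebra
qed

lemma sum_cycle_weight_divide_Suc:
  "(\<Sum>k=1..2*Suc m. cycle_weight (Suc m) k / k) = (\<Sum>k=1..2*m. cycle_weight m k / k) + 1 / (2 * real m + 1)"
proof -
  \<comment> \<open>The difference of the summands for \<open>m + 1\<close> and \<open>m\<close> is Gosper-summable, with antidifference \<open>- r\<close>.\<close>
  define r where "r k = cycle_weight (Suc m) k / (2 * real m + 2 - real k)" for k
  \<comment> \<open>After truncation the sum for \<open>m + 1\<close> has just one term more than
    the sum for \<open>m\<close>, at \<open>k = m + 1\<close>.\<close>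
  have trunc: "(\<Sum>k=1..2*n. cycle_weight n k / k) = (\<Sum>k=1..n. cycle_weight n k / k)" for n
    by (intro sum.mono_neutral_right) (auto simp: cycle_weight_eq_0)
  have step: "cycle_weight (Suc m) k / k - cycle_weight m k / k = r k - r (Suc k)"
    if k: "k \<in> {1..m}" for k
  proof -
    define F where "F = cycle_weight (Suc m) k"
    have pos: "2 * real m + 2 - real k > 0" "2 * real m + 1 - real k > 0" "real k > 0" using k by auto
    have "cycle_weight m k = F * (2 * (real m + 1 - real k) * (2 * real m + 1)) /
        ((2 * real m + 2 - real k) * (2 * real m + 1 - real k))"
      using cycle_weight_Suc_left[of k m] k pos by (simp add: F_def eq_divide_eq)
    moreover have "cycle_weight (Suc m) (Suc k) = F * (2 * real m + 2 - 2 * real k) / (2 * real m + 2 - real k)"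
      using cycle_weight_step[of k "Suc m"] k pos by (simp add: F_def field_simps)
    moreover have "F / k - F * (2 * (real m + 1 - real k) * (2 * real m + 1)) /
        ((2 * real m + 2 - real k) * (2 * real m + 1 - real k)) / k =
        F / (2 * real m + 2 - real k) - F * (2 * real m + 2 - 2 * real k) / (2 * real m + 2 - real k) / (2 * real m + 1 - real k)"
      using pos by (simp add: divide_simps) algebra
    ultimately show ?thesis by (simp add: r_def F_def)
  qed
  \<comment> \<open>At \<open>k = m + 1\<close> the denominator of \<open>r\<close> is
    \<open>m + 1\<close> as well, so the extra term cancels the upper boundary term of the
    telescoping sum.\<close>
  have last: "cycle_weight (Suc m) (Suc m) / Suc m = r (Suc m)"
    by (simp add: r_def)
  have "(\<Sum>k=1..2*Suc m. cycle_weight (Suc m) k / k) - (\<Sum>k=1..2*m. cycle_weight m k / k) =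
     (\<Sum>k=1..m. cycle_weight (Suc m) k / k - cycle_weight m k / k) + r (Suc m)"
    unfolding trunc by (simp add: sum_subtractf last del: of_nat_Suc)
  also have "(\<Sum>k=1..m. cycle_weight (Suc m) k / k - cycle_weight m k / k) = (\<Sum>k=1..m. r k - r (Suc k))"
    using step by (intro sum.cong) auto
  also have "\<dots> = r 1 - r (Suc m)"
    by (induction m) auto
  \<comment> \<open>The recurrence at \<open>k = 0\<close> shows that the weight at 1 equals the
    weight at 0, which is 1.\<close>
  also have "r 1 = 1 / (2 * real m + 1)"
  proof -
    have "cycle_weight (Suc m) 0 = 1" by (simp add: cycle_weight_def del: binomial_Suc_Suc)
    then show ?thesis using cycle_weight_step[of 0 "Suc m"] by (simp add: r_def)
  qed
  finally show ?thesis by simp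
qed

text \<open>The right-hand side is \<open>1 + 1 / 3 + ... + 1 / (2 * m - 1)\<close>, written with
  harmonic numbers so that the limit defining the Euler constant applies.\<close>

lemma sum_cycle_weight_divide:
  "(\<Sum>k=1..2*m. cycle_weight m k / k) = harm (2 * m) - harm m / 2"
proof (induction m)
  case 0
  then show ?case by (simp add: harm_def)
next
  case (Suc m)
  have "harm (2 * Suc m) = harm (2 * m) + 1 / (2 * real m + 1) + 1 / (2 * real m + 2)"
    by (simp add: harm_Suc inverse_eq_divide add.commute)
  moreover have "harm (Suc m) = harm m + 1 / (real m + 1)"
    by (simp add: harm_Suc inverse_eq_divide add.commute)
  moreover have "1 / (2 * real m + 2) = 1 / (real m + 1) / 2" by (simp add: field_simps)
  ultimately show ?case unfolding sum_cycle_weight_divide_Suc Suc by (simp add: add.commute diff_divide_distrib add_divide_distrib)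
qed

text \<open>Replacing harmonic numbers by logarithms leaves
  \<open>ln (2 * m) - ln m / 2 = ln (4 * m) / 2\<close>, and the constants combine to half the Euler
  constant.\<close>

lemma harm_half_asymp:
  "(\<lambda>m. harm (2 * m) - harm m / 2 - (ln (2 * real (2 * m)) + euler_mascheroni) / 2) \<longlonglongrightarrow> (0::real)"
proof -
  let ?e = "\<lambda>m. harm m - ln (real m) :: real"
  have "(\<lambda>m. ?e (2 * m) - ?e m / 2 - euler_mascheroni / 2)
      \<longlonglongrightarrow> euler_mascheroni - euler_mascheroni / 2 - euler_mascheroni / 2"
    by (intro tendsto_intros euler_mascheroni_LIMSEQ
        filterlim_compose[OF euler_mascheroni_LIMSEQ mult_nat_left_at_top]) auto
  moreover have "eventually (\<lambda>m. ?e (2 * m) - ?e m / 2 - euler_mascheroni / 2 =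
     harm (2 * m) - harm m / 2 - (ln (2 * real (2 * m)) + euler_mascheroni) / 2) sequentially"
    using eventually_gt_at_top[of 0]
  proof eventually_elim
    case (elim m)
    have "ln (2 * real (2 * m)) = ln 2 + ln (real (2 * m))" "ln (real (2 * m)) = ln 2 + ln (real m)"
      using elim by (simp_all only: ln_mult of_nat_mult of_nat_numeral) (simp_all add: ln_mult)
    then show ?case by (simp only:) (simp add: field_simps)
  qed
  ultimately show ?thesis by (simp only: tendsto_cong) simp
qed

section \<open>Wallis' product and the central binomial coefficient\<close>

text \<open>Equal to the product of \<open>2 * i / (2 * i - 1)\<close> for \<open>i\<close> from 1
  to \<open>m\<close>, hence the name.\<close>

definition wallis_ratio :: "nat \<Rightarrow> real" where
  "wallis_ratio m = 4 ^ m / real ((2 * m) choose m)"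

lemma wallis_ratio_Suc: "wallis_ratio (Suc m) = wallis_ratio m * (2 * real m + 2) / (2 * real m + 1)"
proof -
  have e: "2 * Suc m = Suc m + Suc m" "2 * m = m + m" by auto
  have cb: "real ((m + i) choose m) = fact (m + i) / (fact m * fact i)" for m i
    by (simp add: binomial_fact)
  have f: "fact (Suc m + Suc m) = (real m + real m + 2) * (real m + real m + 1) * fact (m + m)"
    "fact (Suc m) = (real m + 1) * fact m"
    by (simp_all add: algebra_simps)
  have nz: "real m + real m + 2 \<noteq> 0" "real m + real m + 1 \<noteq> 0" "real m + 1 \<noteq> 0" by linarith+
  show ?thesis unfolding wallis_ratio_def e cb f
    using nz by (simp add: divide_simps) (simp add: algebra_simps)
qed

lemma wallis_ratio_pos: "wallis_ratio m > 0" by (simp add: wallis_ratio_def)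

text \<open>Dividing by \<open>m + 1/2\<close> makes the quotient exactly twice the partial Wallis
  product.\<close>

lemma wallis_ratio_LIMSEQ: "(\<lambda>m. (wallis_ratio m)\<^sup>2 / (real m + 1/2)) \<longlonglongrightarrow> pi"
proof -
  have "(wallis_ratio m)\<^sup>2 / (real m + 1/2) = 2 * (\<Prod>k=1..m. (4*real k^2) / (4*real k^2 - 1))" for m
  proof (induction m)
    case 0
    then show ?case by (simp add: wallis_ratio_def)
  next
    case (Suc m)
    have "(wallis_ratio (Suc m))\<^sup>2 / (real (Suc m) + 1/2) =
       (wallis_ratio m)\<^sup>2 / (real m + 1/2) * ((4*real (Suc m)^2) / (4*real (Suc m)^2 - 1))"
    proof -
      have "4*real (Suc m)^2 - 1 = (2 * real m + 1) * (2 * real m + 3)"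
        by (simp add: algebra_simps power2_eq_square)
      moreover have "2 * real m + 1 > 0" "2 * real m + 3 > 0" by auto
      ultimately show ?thesis unfolding wallis_ratio_Suc
        by (simp add: divide_simps) (simp add: algebra_simps power2_eq_square)
    qed
    then show ?case using Suc by simp
  qed
  then show ?thesis using tendsto_mult_left[OF wallis, of 2] by simp
qed

text \<open>The limit alone would leave an error of order \<open>o(sqrt m)\<close> after taking
  roots. The quotient, however, increases to its limit, which gives an inequality for every
  \<open>m\<close>.\<close>

lemma wallis_ratio_upper: "(wallis_ratio m)\<^sup>2 \<le> pi * (real m + 1/2)"
proof -
  have "incseq (\<lambda>m. (wallis_ratio m)\<^sup>2 / (real m + 1/2))"
  proof (rule incseq_SucI)
    fix m
    define w where "w = (wallis_ratio m)\<^sup>2"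
    have w: "w \<ge> 0" by (simp add: w_def)
    have p: "2 * real m + 1 > 0" "2 * real m + 3 > 0" by auto
    have "(wallis_ratio (Suc m))\<^sup>2 / (real (Suc m) + 1/2) - w / (real m + 1/2) =
       2 * w / ((2 * real m + 1)^2 * (2 * real m + 3))"
      unfolding wallis_ratio_Suc power_mult_distrib power_divide w_def[symmetric]
      using p by (simp add: divide_simps) (simp add: algebra_simps power2_eq_square)
    moreover have "\<dots> \<ge> 0" using w by simp
    ultimately have "w / (real m + 1/2) \<le> (wallis_ratio (Suc m))\<^sup>2 / (real (Suc m) + 1/2)"
      by linarith
    then show "(wallis_ratio m)\<^sup>2 / (real m + 1/2) \<le> (wallis_ratio (Suc m))\<^sup>2 / (real (Suc m) + 1/2)"
      by (simp only: w_def)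
  qed
  from incseq_le[OF this wallis_ratio_LIMSEQ, of m] show ?thesis by (simp add: field_simps)
qed

text \<open>With \<open>m\<close> in place of \<open>m + 1/2\<close> the quotient has the same limit
  but decreases to it.\<close>

lemma wallis_ratio_lower: "pi * real m \<le> (wallis_ratio m)\<^sup>2"
proof (cases "m = 0")
  case False
  let ?u = "\<lambda>m. (wallis_ratio m)\<^sup>2 / real m"
  \<comment> \<open>The index is shifted because the quotient at \<open>m = 0\<close> is 0 by
    convention and would break monotonicity.\<close>
  have dec: "decseq (\<lambda>m. ?u (Suc m))"
  proof (rule decseq_SucI)
    fix m
    define n where "n = Suc m"
    define w where "w = (wallis_ratio n)\<^sup>2"
    have w: "w \<ge> 0" by (simp add: w_def)
    have p: "real n > 0" by (simp add: n_def)
    have p': "2 * real n + 1 > 0" by auto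
    have "w / real n - (wallis_ratio (Suc n))\<^sup>2 / real (Suc n) = w / (real n * (2 * real n + 1)^2)"
      unfolding wallis_ratio_Suc power_mult_distrib power_divide w_def[symmetric]
      using p p' by (simp add: divide_simps) (simp add: algebra_simps power2_eq_square)
    moreover have "\<dots> \<ge> 0" using w by simp
    ultimately have "(wallis_ratio (Suc n))\<^sup>2 / real (Suc n) \<le> w / real n" by linarith
    then show "?u (Suc (Suc m)) \<le> ?u (Suc m)"
      by (simp only: w_def n_def)
  qed
  have "(\<lambda>m. (wallis_ratio m)\<^sup>2 / (real m + 1/2) * ((real m + 1/2) / real m)) \<longlonglongrightarrow> pi * 1"
    by (intro tendsto_mult wallis_ratio_LIMSEQ) real_asymp
  moreover have "(wallis_ratio m)\<^sup>2 / (real m + 1/2) * ((real m + 1/2) / real m) = ?u m" for m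
  proof -
    have "real m + 1/2 > 0" by linarith
    then show ?thesis by simp
  qed
  ultimately have "?u \<longlonglongrightarrow> pi" by simp
  then have "(\<lambda>m. ?u (Suc m)) \<longlonglongrightarrow> pi" by (rule LIMSEQ_Suc)
  from decseq_ge[OF dec this, of "m - 1"] show ?thesis using False by (simp add: field_simps)
qed simp

text \<open>The two bounds place \<open>wallis_ratio m\<close> between \<open>sqrt (pi * m)\<close>
  and \<open>sqrt (pi * (m + 1/2))\<close>, whose difference tends to 0.\<close>

lemma wallis_ratio_asymp:
  "(\<lambda>m. wallis_ratio m - 1 - (sqrt (pi * real (2 * m) / 2) - 1)) \<longlonglongrightarrow> 0"
proof (rule tendsto_sandwich[OF _ _ tendsto_const])
  show "eventually (\<lambda>m. 0 \<le> wallis_ratio m - 1 - (sqrt (pi * real (2 * m) / 2) - 1)) sequentially"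
    using wallis_ratio_lower wallis_ratio_pos
    by (intro always_eventually allI) (auto intro!: real_le_lsqrt simp: less_imp_le)
  show "eventually (\<lambda>m. wallis_ratio m - 1 - (sqrt (pi * real (2 * m) / 2) - 1)
      \<le> sqrt (pi * (real m + 1/2)) - sqrt (pi * real m)) sequentially"
    using wallis_ratio_upper by (intro always_eventually allI) (auto intro!: real_le_rsqrt)
  show "(\<lambda>m. sqrt (pi * (real m + 1/2)) - sqrt (pi * real m)) \<longlonglongrightarrow> 0"
    unfolding real_sqrt_mult right_diff_distrib[symmetric]
    by (rule tendsto_mult_right_zero) real_asymp
qed

section \<open>Functional graphs\<close>

lemma pverts_functional_graph [simp]: "pverts (functional_graph n f) = {1..n}"
  by (simp add: functional_graph_def)

lemma parcs_functional_graph: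
  "(a, b) \<in> parcs (functional_graph n f) \<longleftrightarrow> a \<in> {1..n} \<and> b \<in> {1..n} \<and> f a = b"
  by (simp add: functional_graph_def)

lemma in_degree_functional_graph:
  assumes "v \<in> {1..n}"
  shows "in_degree (with_proj (functional_graph n f)) v = card {a\<in>{1..n}. f a = v}"
proof -
  have "in_arcs (with_proj (functional_graph n f)) v = (\<lambda>a. (a, v)) ` {a\<in>{1..n}. f a = v}"
    using assms by (auto simp: in_arcs_def parcs_functional_graph)
  moreover have "inj_on (\<lambda>a. (a, v)) {a\<in>{1..n}. f a = v}" by (simp add: inj_on_def)
  ultimately show ?thesis by (simp add: in_degree_def card_image)
qed

lemma functional_graph_restrict: "functional_graph n (restrict f {1..n}) = functional_graph n f"
  by (auto simp: functional_graph_def)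

text \<open>The graph sees only the values on \<open>{1..n}\<close>, so each map may be replaced by
  its extensional restriction, and in-degrees are fibre sizes.\<close>

lemma binary_functional_graphs_eq:
  "binary_functional_graphs n = functional_graph n ` binary_maps {1..n}"
proof (intro equalityI subsetI)
  fix G assume "G \<in> binary_functional_graphs n"
  then obtain f where f: "f \<in> {1..n} \<rightarrow> {1..n}" "G = functional_graph n f"
    and deg: "\<forall>v\<in>{1..n}. in_degree (with_proj G) v \<in> {0, 2}"
    by (auto simp: binary_functional_graphs_def functional_graphs_def)
  have "card {a\<in>{1..n}. restrict f {1..n} a = v} \<in> {0, 2}" if "v \<in> {1..n}" for v
    using deg that in_degree_functional_graph[OF that, of "restrict f {1..n}"]
    unfolding f(2) functional_graph_restrict by metis
  then have "restrict f {1..n} \<in> binary_maps {1..n}"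
    using f unfolding binary_maps_def by (intro CollectI conjI ballI restrict_PiE_iff[THEN iffD2]) auto
  then show "G \<in> functional_graph n ` binary_maps {1..n}"
    using f(2) functional_graph_restrict by (metis imageI)
next
  fix G assume "G \<in> functional_graph n ` binary_maps {1..n}"
  then obtain f where f: "f \<in> binary_maps {1..n}" "G = functional_graph n f" by blast
  then show "G \<in> binary_functional_graphs n"
    unfolding binary_functional_graphs_def functional_graphs_def
    using in_degree_functional_graph[of _ n f]
    by (intro CollectI conjI ballI imageI) (auto simp: binary_maps_def)
qed

lemma inj_on_functional_graph: "inj_on (functional_graph n) (binary_maps {1..n})"
proof (rule inj_onI)
  fix f g assume fg: "f \<in> binary_maps {1..n}" "g \<in> binary_maps {1..n}" "functional_graph n f = functional_graph n g"
  have "f x = g x" if "x \<in> {1..n}" for x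
  proof -
    have "f x \<in> {1..n}" using fg(1) that unfolding binary_maps_def by blast
    then have "(x, f x) \<in> parcs (functional_graph n g)"
      using that unfolding fg(3)[symmetric] parcs_functional_graph by simp
    then show ?thesis unfolding parcs_functional_graph by simp
  qed
  then show "f = g" using fg(1,2) unfolding binary_maps_def by (blast intro: PiE_ext)
qed

text \<open>Binary maps correspond bijectively to binary functional graphs, so the uniform
  expectation is an average over maps.\<close>

lemma expected_card_eq:
  assumes "even n"
  shows "expected_card n X =
    (\<Sum>f\<in>binary_maps {1..n}. real (card (X (functional_graph n f)))) / card (binary_maps {1..n})"
  unfolding expected_card_def random_bfg_def
    integral_pmf_of_set[OF binary_functional_graphs_nonempty[OF assms] finite_binary_functional_graphs]
  unfolding binary_functional_graphs_eq sum.reindex[OF inj_on_functional_graph]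
    card_image[OF inj_on_functional_graph] comp_def ..

lemma terminal_nodes_functional_graph:
  "terminal_nodes (functional_graph n f) = {v\<in>{1..n}. {a\<in>{1..n}. f a = v} = {}}"
  unfolding terminal_nodes_def by (auto simp: parcs_functional_graph)

text \<open>Walks are forced: the only arc leaving \<open>u\<close> leads to
  \<open>f u\<close>.\<close>

lemma pcas_functional_graph:
  assumes "pcas u p w" "set p \<subseteq> parcs (functional_graph n f)"
  shows "w = (f ^^ length p) u" "fst ` set p = (\<lambda>i. (f ^^ i) u) ` {..<length p}"
proof -
  have "w = (f ^^ length p) u \<and> fst ` set p = (\<lambda>i. (f ^^ i) u) ` {..<length p}"
    using assms
  proof (induction p arbitrary: u)
    case (Cons e p)
    have e: "e = (u, f u)" using Cons.prems parcs_functional_graph[of "fst e" "snd e" n f] by auto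
    then have IH: "w = (f ^^ length p) (f u)" "fst ` set p = (\<lambda>i. (f ^^ i) (f u)) ` {..<length p}"
      using Cons.IH[of "f u"] Cons.prems by auto
    show ?case
      using IH by (simp add: e funpow_swap1 lessThan_Suc_eq_insert_0 image_image)
  qed simp
  then show "w = (f ^^ length p) u" "fst ` set p = (\<lambda>i. (f ^^ i) u) ` {..<length p}" by auto
qed

text \<open>The general starting index \<open>j\<close> is what the induction on \<open>k\<close>
  requires; only \<open>j = 0\<close> is used afterwards.\<close>

lemma pcas_iterates:
  "pcas ((f ^^ j) v) (map (\<lambda>i. ((f ^^ i) v, (f ^^ Suc i) v)) [j..<j + k]) ((f ^^ (j + k)) v)"
  "pawalk_verts ((f ^^ j) v) (map (\<lambda>i. ((f ^^ i) v, (f ^^ Suc i) v)) [j..<j + k]) =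
    map (\<lambda>i. (f ^^ i) v) [j..<Suc (j + k)]"
proof (induction k arbitrary: j)
  case 0
  { case 1 show ?case by simp }
  { case 2 show ?case by simp }
next
  case (Suc k)
  have u: "[j..<j + Suc k] = j # [Suc j..<Suc j + k]" "[j..<Suc (j + Suc k)] = j # [Suc j..<Suc (Suc j + k)]" for j
    by (simp_all add: upt_conv_Cons del: upt_Suc)
  { case (1 j) show ?case unfolding u using Suc(1)[of "Suc j"] by (simp del: upt_Suc) }
  { case (2 j) show ?case unfolding u using Suc(2)[of "Suc j"] by (simp del: upt_Suc) }
qed

lemma cyclic_nodes_functional_graph:
  assumes f: "f \<in> {1..n} \<rightarrow> {1..n}"
  shows "cyclic_nodes (functional_graph n f) = cyclic_points f {1..n}"
proof (intro equalityI subsetI)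
  let ?G = "with_proj (functional_graph n f)"
  note walk = pre_digraph.cycle_def[of ?G] pre_digraph.awalk_def[of ?G] cas_with_proj_eq awalk_verts_with_proj_eq
  fix v assume "v \<in> cyclic_nodes (functional_graph n f)"
  then obtain p u where v: "v \<in> {1..n}" "v \<in> fst ` set p" and p: "p \<noteq> []" "pcas u p u"
    "set p \<subseteq> parcs (functional_graph n f)"
    unfolding cyclic_nodes_def walk by auto
  from pcas_functional_graph[OF p(2,3)] v(2)
  obtain i where u: "(f ^^ length p) u = u" and i: "v = (f ^^ i) u" by auto
  \<comment> \<open>A closed walk gives a period of its start \<open>u\<close>; iterates of
    \<open>f\<close> commute, so every node on the walk has the same period.\<close>
  have "(f ^^ length p) v = (f ^^ (length p + i)) u" unfolding i by (simp add: funpow_add)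
  also have "\<dots> = (f ^^ i) ((f ^^ length p) u)" by (simp add: funpow_add add.commute)
  finally have "(f ^^ length p) v = v" unfolding u i .
  then have "v \<in> orbit f v" using p(1) unfolding orbit_altdef by force
  then show "v \<in> cyclic_points f {1..n}" using v by (simp add: cyclic_points_def)
next
  let ?G = "with_proj (functional_graph n f)"
  note walk = pre_digraph.cycle_def[of ?G] pre_digraph.awalk_def[of ?G] cas_with_proj_eq awalk_verts_with_proj_eq
  fix v assume "v \<in> cyclic_points f {1..n}"
  then have v: "v \<in> {1..n}" "v \<in> orbit f v" by (simp_all add: cyclic_points_def)
  have fV: "(f ^^ i) v \<in> {1..n}" for i
    using v f by (induction i) (auto simp del: atLeastAtMost_iff)
  define k where "k = funpow_dist1 f v v"
  have k: "k > 0" "(f ^^ k) v = v" and inj: "inj_on (\<lambda>i. (f ^^ i) v) {0..<k}"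
    using funpow_dist1_prop[OF v(2)] inj_on_funpow_dist1[OF v(2)] by (simp_all add: k_def del: funpow.simps)
  define p where "p = map (\<lambda>i. ((f ^^ i) v, (f ^^ Suc i) v)) [0..<k]"
  have cas: "pcas v p v" and verts: "pawalk_verts v p = map (\<lambda>i. (f ^^ i) v) [0..<Suc k]"
    using pcas_iterates[of 0 f v k] k by (simp_all add: p_def)
  have "tl (pawalk_verts v p) = map (\<lambda>i. (f ^^ i) v) [Suc 0..<Suc k]"
    unfolding verts by (simp add: upt_conv_Cons del: upt_Suc)
  moreover have "distinct \<dots>"
    unfolding distinct_map
  proof (intro conjI inj_onI)
    fix i j assume ij: "i \<in> set [Suc 0..<Suc k]" "j \<in> set [Suc 0..<Suc k]" "(f ^^ i) v = (f ^^ j) v"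
    \<comment> \<open>A cycle needs the iterates 1 to \<open>k\<close> to be distinct, whereas
      injectivity is known for 0 to \<open>k - 1\<close>. Reduction modulo \<open>k\<close> matches
      the two ranges.\<close>
    have "(f ^^ (i mod k)) v = (f ^^ (j mod k)) v"
      using ij(3) k by (simp add: funpow_mod_eq)
    then have "i mod k = j mod k" using inj k by (simp add: inj_on_def)
    then show "i = j" using ij(1,2) by (cases "i = k"; cases "j = k") auto
  qed simp
  ultimately have "distinct (tl (pawalk_verts v p))" by simp
  moreover have "p \<noteq> []" using k by (simp add: p_def)
  moreover have "set p \<subseteq> parcs (functional_graph n f)"
    using fV fV[of "Suc _"] by (auto simp: p_def parcs_functional_graph simp del: atLeastAtMost_iff)
  ultimately have "pre_digraph.cycle ?G p" unfolding walk using cas v by auto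
  moreover have "v \<in> fst ` set p" using k by (force simp: p_def)
  ultimately show "v \<in> cyclic_nodes (functional_graph n f)"
    unfolding cyclic_nodes_def using v by auto
qed

section \<open>Connected components and cycles\<close>

text \<open>Equal kernels make \<open>h\<close> factor injectively through \<open>g\<close>. This
  will compare components with orbits, both indexed by cyclic points.\<close>

lemma card_image_eq_if_same_kernel:
  assumes "\<And>x y. x \<in> A \<Longrightarrow> y \<in> A \<Longrightarrow> g x = g y \<longleftrightarrow> h x = h y"
  shows "card (g ` A) = card (h ` A)"
proof -
  let ?\<phi> = "\<lambda>c. h (inv_into A g c)"
  have \<phi>: "?\<phi> (g x) = h x" if "x \<in> A" for x
    using assms[of "inv_into A g (g x)" x] that by (simp add: inv_into_into f_inv_into_f)
  have "inj_on ?\<phi> (g ` A)"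
    using \<phi> assms by (auto simp: inj_on_def)
  moreover have "?\<phi> ` g ` A = h ` A" using \<phi> by (force simp: image_image)
  ultimately show ?thesis using card_image by metis
qed

text \<open>By the pigeonhole principle two iterates \<open>i < j\<close> coincide, and the
  \<open>i\<close>-th one then returns to itself after \<open>j - i\<close> steps.\<close>

lemma ex_iterate_cyclic:
  assumes "finite V" "f \<in> V \<rightarrow> V" "v \<in> V"
  shows "\<exists>i. (f ^^ i) v \<in> cyclic_points f V"
proof -
  have fV: "(f ^^ i) v \<in> V" for i using assms by (induction i) auto
  then have "\<not> inj (\<lambda>i. (f ^^ i) v)"
    using assms(1) finite_imageD[of "\<lambda>i. (f ^^ i) v" UNIV] by (metis finite_subset image_subsetI infinite_UNIV_nat)
  then obtain i j where ij: "i < j" "(f ^^ i) v = (f ^^ j) v"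
    unfolding inj_def by (metis nat_neq_iff)
  have "(f ^^ (j - i)) ((f ^^ i) v) = (f ^^ (j - i + i)) v"
    by (simp only: funpow_add comp_apply)
  also have "j - i + i = j" using ij(1) by simp
  also have "(f ^^ j) v = (f ^^ i) v" using ij(2) ..
  finally have "\<exists>k. (f ^^ i) v = (f ^^ k) ((f ^^ i) v) \<and> 0 < k"
    using ij(1) by (intro exI[of _ "j - i"]) simp
  then have "(f ^^ i) v \<in> orbit f ((f ^^ i) v)" unfolding orbit_altdef by blast
  then show ?thesis using fV by (auto simp: cyclic_points_def)
qed

lemma orbit_funpow:
  assumes "x \<in> orbit f x"
  shows "orbit f ((f ^^ i) x) = orbit f x"
  using assms
proof (induction i)
  case (Suc i)
  then have "(f ^^ i) x \<in> orbit f ((f ^^ i) x)" by (simp add: funpow_in_orbit)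
  then show ?case using Suc self_in_orbit_step[of "(f ^^ i) x" f] by simp
qed simp

text \<open>Every component contains exactly one cycle. Each node runs into a cycle, so cyclic
  points represent all components, and two of them are connected iff they have the same
  orbit.\<close>

lemma card_graph_components_functional_graph:
  assumes f: "f \<in> {1..n} \<rightarrow> {1..n}"
  shows "card (graph_components (functional_graph n f)) = card (orbit f ` cyclic_points f {1..n})"
proof -
  let ?V = "{1..n}"
  define H where "H = mk_symmetric (with_proj (functional_graph n f))"
  have verts: "pverts H = ?V" by (simp add: H_def)
  have arc: "(a, b) \<in> parcs H \<longleftrightarrow> a \<in> ?V \<and> b \<in> ?V \<and> (f a = b \<or> f b = a)" for a b
    by (auto simp: H_def parcs_mk_symmetric functional_graph_def)
  interpret H: pair_sym_digraph H
    by unfold_locales (auto simp: verts arc symmetric_def sym_def simp del: atLeastAtMost_iff)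
  have V: "(f ^^ i) v \<in> ?V" if "v \<in> ?V" for i v
    using that f by (induction i) (auto simp del: atLeastAtMost_iff)
  have step: "u \<rightarrow>\<^sup>*\<^bsub>H\<^esub> (f ^^ i) u" if "u \<in> ?V" for u i
  proof (induction i)
    case 0
    then show ?case using that by (simp add: verts H.reachable_refl)
  next
    case (Suc i)
    have "((f ^^ i) u, (f ^^ Suc i) u) \<in> parcs H"
      unfolding arc using V[OF that] V[OF that, of "Suc i"] by simp
    then show ?case using Suc H.reachable_adj_trans by simp
  qed
  \<comment> \<open>Two nodes are connected iff their forward paths meet. Along an undirected walk,
    each edge costs one more application of \<open>f\<close> on one of the two sides.\<close>
  have reach: "u \<rightarrow>\<^sup>*\<^bsub>H\<^esub> v \<longleftrightarrow> (\<exists>i j. (f ^^ i) u = (f ^^ j) v)" if uv: "u \<in> ?V" "v \<in> ?V" for u v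
  proof
    assume "u \<rightarrow>\<^sup>*\<^bsub>H\<^esub> v"
    then show "\<exists>i j. (f ^^ i) u = (f ^^ j) v"
    proof (induction rule: H.reachable_induct)
      case base
      show ?case by blast
    next
      case (step x y)
      then obtain i j where ij: "(f ^^ i) u = (f ^^ j) x" by blast
      from step have "f x = y \<or> f y = x" using arc by simp
      then show ?case
      proof
        assume "f x = y"
        then have "(f ^^ Suc i) u = (f ^^ j) y" using ij by (simp add: funpow_swap1)
        then show ?thesis by blast
      next
        assume "f y = x"
        then have "(f ^^ i) u = (f ^^ Suc j) y" using ij by (simp add: funpow_swap1)
        then show ?thesis by blast
      qed
    qed
  next
    assume "\<exists>i j. (f ^^ i) u = (f ^^ j) v"
    then obtain i j where "(f ^^ i) u = (f ^^ j) v" by blast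
    then show "u \<rightarrow>\<^sup>*\<^bsub>H\<^esub> v"
      using step[OF uv(1), of i] step[OF uv(2), of j] symmetric_reachable[OF H.sym_arcs] H.reachable_trans by metis
  qed
  have scc: "H.scc_of u = H.scc_of v \<longleftrightarrow> (\<exists>i j. (f ^^ i) u = (f ^^ j) v)" if uv: "u \<in> ?V" "v \<in> ?V" for u v
  proof -
    have "H.scc_of u = H.scc_of v \<longleftrightarrow> u \<rightarrow>\<^sup>*\<^bsub>H\<^esub> v"
    proof
      assume "H.scc_of u = H.scc_of v"
      then have "u \<in> H.scc_of v" using uv H.in_scc_of_self[of u] by (simp add: verts)
      then show "u \<rightarrow>\<^sup>*\<^bsub>H\<^esub> v" by (simp add: H.scc_of_def)
    next
      assume "u \<rightarrow>\<^sup>*\<^bsub>H\<^esub> v"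
      then show "H.scc_of u = H.scc_of v"
        using symmetric_reachable[OF H.sym_arcs] H.reachable_trans unfolding H.scc_of_def by blast
    qed
    then show ?thesis using reach[OF uv] by simp
  qed
  have cyc: "cyclic_points f ?V \<subseteq> ?V" by (auto simp: cyclic_points_def)
  have "graph_components (functional_graph n f) = H.sccs"
    by (simp add: graph_components_def H_def)
  then have "card (graph_components (functional_graph n f)) = card H.sccs_verts"
    using H.card_sccs_verts by simp
  also have "H.sccs_verts = H.scc_of ` ?V"
    using H.sccs_verts_conv_scc_of by (simp add: verts)
  also have "\<dots> = H.scc_of ` cyclic_points f ?V"
  proof (intro equalityI image_subsetI)
    fix v assume v: "v \<in> ?V"
    obtain i where i: "(f ^^ i) v \<in> cyclic_points f ?V"
      using ex_iterate_cyclic[OF _ f v] by auto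
    have "(f ^^ i) v = (f ^^ 0) ((f ^^ i) v)" by simp
    then have "H.scc_of v = H.scc_of ((f ^^ i) v)" using scc[OF v V[OF v]] by blast
    then show "H.scc_of v \<in> H.scc_of ` cyclic_points f ?V" using i by blast
  qed (use cyc in blast)
  also have "card \<dots> = card (orbit f ` cyclic_points f ?V)"
  proof (rule card_image_eq_if_same_kernel)
    fix x y assume xy: "x \<in> cyclic_points f ?V" "y \<in> cyclic_points f ?V"
    then have self: "x \<in> orbit f x" "y \<in> orbit f y" by (simp_all add: cyclic_points_def)
    have "(\<exists>i j. (f ^^ i) x = (f ^^ j) y) \<longleftrightarrow> orbit f x = orbit f y"
    proof
      assume "\<exists>i j. (f ^^ i) x = (f ^^ j) y"
      then show "orbit f x = orbit f y" using orbit_funpow self by metis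
    next
      assume "orbit f x = orbit f y"
      then have "y \<in> orbit f x" using self by simp
      then obtain i where "y = (f ^^ i) x" unfolding orbit_altdef by blast
      then have "(f ^^ i) x = (f ^^ 0) y" by simp
      then show "\<exists>i j. (f ^^ i) x = (f ^^ j) y" by blast
    qed
    then show "H.scc_of x = H.scc_of y \<longleftrightarrow> orbit f x = orbit f y"
      using scc[of x y] xy cyc by blast
  qed
  finally show ?thesis .
qed

section \<open>Expected values\<close>

lemma binary_maps_nonempty: "even (n :: nat) \<Longrightarrow> binary_maps {1..n} \<noteq> {}"
  using binary_functional_graphs_nonempty[of n] by (simp add: binary_functional_graphs_eq)

lemma expected_card_eqI:
  assumes "\<And>f. f \<in> binary_maps {1..2 * m} \<Longrightarrow>
      real (card (X (functional_graph (2 * m) f))) = (\<Sum>x\<in>cyclic_points f {1..2 * m}. w (card (orbit f x)))"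
  shows "expected_card (2 * m) X = (\<Sum>k=1..2 * m. w k * cycle_weight m k)"
proof -
  have "real (card (binary_maps {1..2 * m})) \<noteq> 0"
    using binary_maps_nonempty[of "2 * m"] finite_binary_maps[of "{1..2 * m}"] by simp
  moreover have "(\<Sum>f\<in>binary_maps {1..2 * m}. real (card (X (functional_graph (2 * m) f)))) =
      (\<Sum>k=1..2 * m. w k * cycle_weight m k) * real (card (binary_maps {1..2 * m}))"
    using sum_binary_maps_cyclic_points[of "{1..2 * m}" m w] assms by simp
  ultimately show ?thesis using expected_card_eq[of "2 * m" X] by simp
qed

lemma binary_maps_funcset: "f \<in> binary_maps V \<Longrightarrow> f \<in> V \<rightarrow> V"
  by (auto simp: binary_maps_def)

lemma expected_graph_components:
  "expected_card (2 * m) graph_components = harm (2 * m) - harm m / 2"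
proof -
  have "expected_card (2 * m) graph_components = (\<Sum>k=1..2 * m. 1 / real k * cycle_weight m k)"
    using card_cycles[of "{1..2 * m}"]
    by (intro expected_card_eqI) (simp add: card_graph_components_functional_graph binary_maps_funcset)
  then show ?thesis using sum_cycle_weight_divide[of m] by simp
qed

lemma expected_cyclic_nodes: "expected_card (2 * m) cyclic_nodes = wallis_ratio m - 1"
proof -
  have "expected_card (2 * m) cyclic_nodes = (\<Sum>k=1..2 * m. 1 * cycle_weight m k)"
    by (intro expected_card_eqI) (simp add: cyclic_nodes_functional_graph binary_maps_funcset)
  then show ?thesis using sum_cycle_weight[of m] by (simp add: wallis_ratio_def)
qed

lemma expected_card_Diff:
  assumes "even n" "\<And>G. Y G = pverts G - X G" "\<And>G. X G \<subseteq> pverts G"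
  shows "expected_card n Y = real n - expected_card n X"
proof -
  have "real (card (Y (functional_graph n f))) = real n - real (card (X (functional_graph n f)))" for f
    using assms(3)[of "functional_graph n f"] card_mono[OF _ assms(3), of "functional_graph n f"]
    by (simp add: assms(2) card_Diff_subset finite_subset of_nat_diff)
  moreover have "real (card (binary_maps {1..n})) \<noteq> 0"
    using binary_maps_nonempty[OF assms(1)] finite_binary_maps[of "{1..n}"] by simp
  ultimately show ?thesis
    by (simp add: expected_card_eq[OF assms(1)] sum_subtractf diff_divide_distrib)
qed

lemma expected_tail_nodes: "even n \<Longrightarrow> expected_card n tail_nodes = real n - expected_card n cyclic_nodes"
  by (rule expected_card_Diff) (auto simp: tail_nodes_def cyclic_nodes_def)

lemma expected_terminal_nodes:
  assumes "even n"
  shows "expected_card n terminal_nodes = real n / 2"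
proof -
  have "real (card (terminal_nodes (functional_graph n f))) = real n / 2" if "f \<in> binary_maps {1..n}" for f
    using arg_cong[OF card_unhit_binary_map[OF _ that], of real]
    by (simp add: terminal_nodes_functional_graph)
  then have "(\<Sum>f\<in>binary_maps {1..n}. real (card (terminal_nodes (functional_graph n f)))) =
      real (card (binary_maps {1..n})) * (real n / 2)"
    by (simp only: sum_constant cong: sum.cong)
  then show ?thesis
    using binary_maps_nonempty[OF assms] finite_binary_maps[of "{1..n}"]
    by (simp add: expected_card_eq[OF assms])
qed

lemma expected_image_nodes: "even n \<Longrightarrow> expected_card n image_nodes = real n / 2"
  using expected_card_Diff[of n image_nodes terminal_nodes] expected_terminal_nodes[of n]
  by (auto simp: image_nodes_def terminal_nodes_def)

text \<open>Reduces limits along even \<open>n\<close> to ordinary limits in \<open>m\<close> with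
  \<open>n = 2 * m\<close>.\<close>

lemma even_at_top_le: "even_at_top \<le> filtermap (\<lambda>m. 2 * m) sequentially"
proof (rule filter_leI)
  fix P :: "nat \<Rightarrow> bool"
  assume "eventually P (filtermap (\<lambda>m. 2 * m) sequentially)"
  then obtain M where M: "\<And>m. m \<ge> M \<Longrightarrow> P (2 * m)"
    by (auto simp: eventually_filtermap eventually_sequentially)
  have "P n" if "n \<ge> 2 * M" "even n" for n
    using M[of "n div 2"] that by auto
  then show "eventually P even_at_top"
    by (auto simp: even_at_top_def eventually_inf_principal eventually_sequentially)
qed

lemma smallo_even_at_topI:
  fixes h :: "nat \<Rightarrow> real"
  assumes "(\<lambda>m. h (2 * m)) \<longlonglongrightarrow> 0"
  shows "h \<in> o[even_at_top](\<lambda>_. 1)"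
proof (rule smalloI_tendsto)
  have "filterlim h (nhds 0) (filtermap (\<lambda>m. 2 * m) sequentially)"
    using assms by (simp add: filterlim_filtermap)
  then show "((\<lambda>n. h n / 1) \<longlongrightarrow> 0) even_at_top"
    using filterlim_mono[OF _ order_refl even_at_top_le] by simp
qed simp

theorem theorem5:
  shows
    "(\<lambda>n. expected_card n graph_components - (ln (2 * real n) + euler_mascheroni) / 2)
       \<in> o[even_at_top](\<lambda>n. 1 :: real) \<and>
     (\<lambda>n. expected_card n cyclic_nodes - (sqrt (pi * real n / 2) - 1))
       \<in> o[even_at_top](\<lambda>n. 1 :: real) \<and>
     (\<lambda>n. expected_card n tail_nodes - (real n - sqrt (pi * real n / 2) + 1))
       \<in> o[even_at_top](\<lambda>n. 1 :: real) \<and>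
     (\<lambda>n. expected_card n terminal_nodes - real n / 2)
       \<in> o[even_at_top](\<lambda>n. 1 :: real) \<and>
     (\<lambda>n. expected_card n image_nodes - real n / 2)
       \<in> o[even_at_top](\<lambda>n. 1 :: real)"
proof (intro conjI smallo_even_at_topI)
  show "(\<lambda>m. expected_card (2 * m) graph_components -
      (ln (2 * real (2 * m)) + euler_mascheroni) / 2) \<longlonglongrightarrow> 0"
    unfolding expected_graph_components by (rule harm_half_asymp)
  show cyclic: "(\<lambda>m. expected_card (2 * m) cyclic_nodes - (sqrt (pi * real (2 * m) / 2) - 1)) \<longlonglongrightarrow> 0"
    unfolding expected_cyclic_nodes by (rule wallis_ratio_asymp)
  show "(\<lambda>m. expected_card (2 * m) tail_nodes -
      (real (2 * m) - sqrt (pi * real (2 * m) / 2) + 1)) \<longlonglongrightarrow> 0"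
    \<comment> \<open>Tail nodes are the complement of cyclic nodes, so their error term is the
      negated one.\<close>
    using tendsto_minus[OF cyclic] by (simp add: expected_tail_nodes algebra_simps)
  show "(\<lambda>m. expected_card (2 * m) terminal_nodes - real (2 * m) / 2) \<longlonglongrightarrow> 0"
    by (simp add: expected_terminal_nodes)
  show "(\<lambda>m. expected_card (2 * m) image_nodes - real (2 * m) / 2) \<longlonglongrightarrow> 0"
    by (simp add: expected_image_nodes)
qed

end
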